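(* Let $Z_1,Z_2,\dots$ be i.i.d. random variables (with generic copy $Z$), let $T$ be a stopping time associated with this sequence, and let $S_T:=Z_1+\dots+Z_T$. If $\mathbb{P}(T<\infty)=\tilde{\mathbb{P}}_w(T<\infty)=1$, then $$\mathbb{E}\left(u^{T}e^{wS_T}\right)=\tilde{\mathbb{E}}_w\left(\left(u\,\mathbb{E}(e^{wZ})\right)^{T}\right)$$ for all real $u,w$ such that the expectations $\mathbb{E}\left(u^{T}e^{wS_T}\right)$ and $\tilde{\mathbb{E}}_w\left(\left(u\,\mathbb{E}(e^{wZ})\right)^{T}\right)$ exist. In particular, $\mathbb{E}(e^{wS_T})=\tilde{\mathbb{E}}_w\left(\mathbb{E}(e^{wZ})^{T}\right)$.
   Context: Let $F$ be a probability distribution on $\mathbf{R}$ with $\int_{\mathbf{R}} e^{wz}\,dF(z)<\infty$ for all $w$ in an interval $\mathcal{W}$ containing $0$. Let $\Omega=\mathbf{R}^{\mathbf{N}}$, $\mathbf{N}=\{1,2,\dots\}$, let $Z_i:\Omega\to\mathbf{R}$, $Z_i(\mathbf{x})=x_i$, be the coordinate maps, and let $\mathcal{F}=\sigma(Z_1,Z_2,\dots)$. For $w\in\mathcal{W}$, let $F(\cdot|w)$ be the exponentially tilted distribution $F(x|w)=\int_{(-\infty,x]}e^{wz}\,dF(z)\big/\int_{\mathbf{R}}e^{wz}\,dF(z)$, $x\in\mathbf{R}$, and let $\tilde{\mathbb{P}}_w$ be the (product) probability measure on $(\Omega,\mathcal{F})$ under which $Z_1,Z_2,\dots$ are independent with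 common distribution $F(\cdot|w)$. Write $\mathbb{P}:=\tilde{\mathbb{P}}_0$ (so $Z_i\sim F$ under $\mathbb{P}$), $\tilde{\mathbb{E}}_w$ for expectation under $\tilde{\mathbb{P}}_w$, and $\mathbb{E}:=\tilde{\mathbb{E}}_0$. Let $\mathcal{F}_n=\sigma(Z_1,\dots,Z_n)$. A stopping time associated with $Z_1,Z_2,\dots$ is a map $T:\Omega\to\{1,2,\dots\}\cup\{\infty\}$ with $[T=n]\in\mathcal{F}_n$ for every $n=1,2,\dots$. Real $w$ ranges over values for which $\tilde{\mathbb{P}}_w$ is defined ($w\in\mathcal{W}$), and an expectation "exists" when the integrand is (absolutely) integrable. *)

theory Defs
  imports "HOL-Probability.Probability"
begin

definition tilted_cdf :: "real measure \<Rightarrow> real \<Rightarrow> real \<Rightarrow> real" where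
  "tilted_cdf F w x = (LINT z:{..x}|F. exp (w * z)) / (LINT z|F. exp (w * z))"

definition tilted :: "real measure \<Rightarrow> real \<Rightarrow> real measure" where
  "tilted F w = interval_measure (tilted_cdf F w)"

text \<open>The Stieltjes measure \<^const>\<open>interval_measure\<close> is meaningful only for nondecreasing,
  right-continuous functions; the next lemmas show that no junk value arises in \<^const>\<open>tilted\<close>
  when the exponential moment is finite.\<close>

lemma real_distribution_tilted_density:
  assumes "real_distribution F" and "integrable F (\<lambda>z. exp (w * z))"
  defines "D \<equiv> density F (\<lambda>z. ennreal (exp (w * z) / (LINT z|F. exp (w * z))))"
  shows "real_distribution D" and "cdf D = tilted_cdf F w"
proof -
  interpret F: real_distribution F by fact
  let ?m = "LINT z|F. exp (w * z)"
  have "?m > 0"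
    using F.expectation_less[of "\<lambda>z. - exp (w * z)" 0] assms(2) by simp
  have em: "emeasure D A = ennreal ((LINT z:A|F. exp (w * z)) / ?m)" if "A \<in> sets borel" for A
  proof -
    have "emeasure D A = (\<integral>\<^sup>+z. ennreal (indicat_real A z * exp (w * z) / ?m) \<partial>F)"
      unfolding D_def using that
      by (subst emeasure_density) (auto intro!: nn_integral_cong simp: indicator_def)
    also have "\<dots> = ennreal (LINT z|F. indicat_real A z * exp (w * z) / ?m)"
      using that assms(2) \<open>?m > 0\<close>
      by (intro nn_integral_eq_integral integrable_divide_zero impI
          integrable_mult_indicator[where 'b = real, simplified]) auto
    finally show ?thesis
      by (simp add: set_lebesgue_integral_def)
  qed
  have "emeasure D (space D) = 1"
    using em[of UNIV] \<open>?m > 0\<close> by (simp add: D_def set_lebesgue_integral_def)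
  then show "real_distribution D"
    by (intro real_distribution.intro real_distribution_axioms.intro prob_spaceI)
       (auto simp: D_def)
  show "cdf D = tilted_cdf F w"
    using \<open>?m > 0\<close>
    by (auto simp: cdf_def measure_def em tilted_cdf_def fun_eq_iff set_lebesgue_integral_def
        intro!: enn2real_ennreal divide_nonneg_pos Bochner_Integration.integral_nonneg)
qed

lemma tilted_eq_density:
  assumes "real_distribution F" and "integrable F (\<lambda>z. exp (w * z))"
  shows "tilted F w = density F (\<lambda>z. ennreal (exp (w * z) / (LINT z|F. exp (w * z))))"
    (is "_ = ?D")
proof -
  interpret D: real_distribution ?D
    using assms by (rule real_distribution_tilted_density)
  have D: "tilted_cdf F w = cdf ?D"
    using assms by (simp add: real_distribution_tilted_density)
  show ?thesis
    unfolding tilted_def D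
    by (intro cdf_unique real_distribution_interval_measure cdf_interval_measure
        D.real_distribution_axioms D.cdf_nondecreasing D.cdf_is_right_cont
        D.cdf_lim_at_bot D.cdf_lim_at_top_prob)
qed

definition Omega :: "(nat \<Rightarrow> real) set" where
  "Omega = {1..} \<rightarrow>\<^sub>E UNIV"

definition Z :: "nat \<Rightarrow> (nat \<Rightarrow> real) \<Rightarrow> real" where
  "Z i \<omega> = \<omega> i"

definition S :: "nat \<Rightarrow> (nat \<Rightarrow> real) \<Rightarrow> real" where
  "S n \<omega> = (\<Sum>i = 1..n. Z i \<omega>)"

definition tilted_prob :: "real measure \<Rightarrow> real \<Rightarrow> (nat \<Rightarrow> real) measure" where
  "tilted_prob F w = (\<Pi>\<^sub>M i\<in>{1..}. tilted F w)"

lemma space_tilted_prob: "space (tilted_prob F w) = Omega"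
  by (simp add: tilted_prob_def Omega_def space_PiM tilted_def)

definition generated_sigma :: "nat \<Rightarrow> (nat \<Rightarrow> real) set set" where
  "generated_sigma n =
     sigma_sets Omega {Z i -` A \<inter> Omega | i A. i \<in> {1..n} \<and> A \<in> sets borel}"

definition stopping_time_Z :: "((nat \<Rightarrow> real) \<Rightarrow> enat) \<Rightarrow> bool" where
  "stopping_time_Z T \<longleftrightarrow>
     (\<forall>\<omega>\<in>Omega. T \<omega> \<ge> 1) \<and> (\<forall>n\<ge>1. {\<omega>\<in>Omega. T \<omega> = enat n} \<in> generated_sigma n)"

text \<open>Evaluation of a random sequence at \<open>T\<close>. The value \<open>0\<close> on \<open>T = \<infinity>\<close> is a convention that
  matters only where that event has positive probability.\<close>

definition at_time :: "(nat \<Rightarrow> (nat \<Rightarrow> real) \<Rightarrow> real) \<Rightarrow> ((nat \<Rightarrow> real) \<Rightarrow> enat) \<Rightarrow>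
    (nat \<Rightarrow> real) \<Rightarrow> real" where
  "at_time X T \<omega> = (case T \<omega> of enat n \<Rightarrow> X n \<omega> | \<infinity> \<Rightarrow> 0)"

end

theory Submission
  imports Defs
begin

text \<open>
  Write \<open>m\<close> for the exponential moment of \<open>F\<close> at \<open>w\<close>. The proof is a change of measure. Tilting
  one coordinate multiplies its law by the density \<open>exp (w * z) / m\<close>, so by independence the
  restriction of \<open>Pw\<close> to the first \<open>n\<close> coordinates has the density \<open>L n = exp (w * S n) / m ^ n\<close>
  with respect to \<open>P\<close>. On the whole sequence space no density need exist, but the event \<open>T = n\<close>
  lives on the first \<open>n\<close> coordinates. So under \<open>Pw\<close> it has the mass that \<open>P\<close> weighted by \<open>L n\<close>
  gives it, which is Wald's likelihood ratio identity \<open>Pw (T = n) = \<integral>{T = n}. L n \<partial>P\<close>.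

  The claim involves \<open>Pw\<close> only through the law of \<open>T\<close>. As \<open>T\<close> has countably many
  values and is finite \<open>Pw\<close>-almost surely, these identities determine this law: it is the
  law of \<open>T\<close> under the measure with density \<open>L T\<close> with respect to \<open>P\<close>
  (\<open>distr_stopping_time_Pw\<close>). Integrating \<open>h T\<close> against it gives
  \<open>wald_likelihood_ratio_identity\<close>, and for \<open>h n = (u * m) ^ n\<close> the factor \<open>m ^ n\<close> cancels.

  The link between \<open>Pw\<close> and \<open>P\<close> on the first \<open>n\<close> coordinates is
  \<open>emeasure_Pw_generated_sigma\<close>: cylinders factorise coordinatewise by
  \<open>nn_integral_PiM_prod\<close>, and they form an intersection-stable generator.
\<close>

section \<open>Products over finitely many coordinates, and cylinders\<close>

text \<open>The integrand sees only the coordinates in \<open>J\<close>, whose joint law is the finite product over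
  \<open>J\<close>, where Tonelli's theorem applies.\<close>

lemma (in product_prob_space) nn_integral_PiM_prod:
  assumes J: "finite J" "J \<subseteq> I"
    and f: "\<And>i. i \<in> J \<Longrightarrow> f i \<in> borel_measurable (M i)"
  shows "(\<integral>\<^sup>+\<omega>. (\<Prod>i\<in>J. f i (\<omega> i)) \<partial>PiM I M) = (\<Prod>i\<in>J. integral\<^sup>N (M i) (f i))"
proof -
  have f_comp: "(\<lambda>\<omega>. f i (\<omega> i)) \<in> borel_measurable (PiM J M)" if "i \<in> J" for i
    using that f by (intro measurable_compose[OF measurable_component_singleton]) auto
  have "(\<Prod>i\<in>J. integral\<^sup>N (M i) (f i)) = (\<integral>\<^sup>+\<omega>. (\<Prod>i\<in>J. f i (\<omega> i)) \<partial>PiM J M)"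
    using J(1) f by (intro product_nn_integral_prod[symmetric])
  also have "\<dots> = (\<integral>\<^sup>+\<omega>. (\<Prod>i\<in>J. f i (restrict \<omega> J i)) \<partial>PiM I M)"
    using J f_comp
    by (subst distr_PiM_restrict_finite[OF J, symmetric])
       (intro nn_integral_distr measurable_restrict_subset borel_measurable_prod_ennreal, auto)
  finally show ?thesis
    by simp
qed

text \<open>The events that generate \<open>generated_sigma n\<close> constrain one coordinate each and are not closed
  under intersection. Constraining the coordinates \<open>1, \<dots>, n\<close> simultaneously repairs this, as the
  uniqueness theorem for measures requires.\<close>

definition cylinders :: "nat \<Rightarrow> (nat \<Rightarrow> real) set set" where
  "cylinders n = {{\<omega>\<in>Omega. \<forall>i\<in>{1..n}. \<omega> i \<in> X i} | X. \<forall>i. X i \<in> sets borel}"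

lemma Int_stable_cylinders: "Int_stable (cylinders n)"
proof (rule Int_stableI)
  fix a b assume "a \<in> cylinders n" "b \<in> cylinders n"
  then obtain X Y where
    "a = {\<omega>\<in>Omega. \<forall>i\<in>{1..n}. \<omega> i \<in> X i}" "\<forall>i. X i \<in> sets borel"
    "b = {\<omega>\<in>Omega. \<forall>i\<in>{1..n}. \<omega> i \<in> Y i}" "\<forall>i. Y i \<in> sets borel"
    unfolding cylinders_def by blast
  then show "a \<inter> b \<in> cylinders n"
    unfolding cylinders_def by (intro CollectI exI[of _ "\<lambda>i. X i \<inter> Y i"]) auto
qed

lemma generated_sigma_subset_cylinders:
  "generated_sigma n \<subseteq> sigma_sets Omega (cylinders n)"
  unfolding generated_sigma_def
proof (rule sigma_sets_mono', safe)
  fix i :: nat and A :: "real set" assume "i \<in> {1..n}" "A \<in> sets borel"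
  then show "Z i -` A \<inter> Omega \<in> cylinders n"
    unfolding cylinders_def
    by (intro CollectI exI[of _ "\<lambda>j. if j = i then A else UNIV"]) (auto simp: Z_def)
qed

section \<open>Densities on finitely many coordinates\<close>

locale exponential_tilt = real_distribution F for F :: "real measure" +
  fixes w :: real
  assumes integrable_exp: "integrable F (\<lambda>z. exp (w * z))"
begin

definition mgf :: real where
  "mgf = (LINT z|F. exp (w * z))"

lemma mgf_pos: "mgf > 0"
  unfolding mgf_def using expectation_less[of "\<lambda>z. - exp (w * z)" 0] integrable_exp by simp

lemma tilted_w: "tilted F w = density F (\<lambda>z. ennreal (exp (w * z) / mgf))"
  unfolding mgf_def using real_distribution_axioms integrable_exp by (rule tilted_eq_density)

lemma tilted_0: "tilted F 0 = F"
  by (subst tilted_eq_density[OF real_distribution_axioms])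
     (simp_all add: prob_space[simplified] density_1)

sublocale P: product_prob_space "\<lambda>_. F" "{1::nat..}"
  by (intro product_prob_spaceI prob_space_axioms)

sublocale Pw: product_prob_space "\<lambda>_. tilted F w" "{1::nat..}"
proof (intro product_prob_spaceI)
  show "prob_space (tilted F w)"
    unfolding tilted_w mgf_def
    using real_distribution_tilted_density(1)[OF real_distribution_axioms integrable_exp]
    by (rule real_distribution.axioms)
qed

abbreviation "P \<equiv> tilted_prob F 0"
abbreviation "Pw \<equiv> tilted_prob F w"

lemma P_eq: "P = PiM {1..} (\<lambda>_. F)"
  by (simp add: tilted_prob_def tilted_0)

lemma Pw_eq: "Pw = PiM {1..} (\<lambda>_. tilted F w)"
  by (simp add: tilted_prob_def)

lemma prob_space_Pw: "prob_space Pw"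
  unfolding Pw_eq by (rule Pw.prob_space_axioms)

lemma sets_tilted: "sets (tilted F v) = sets borel"
  by (simp add: tilted_def)

lemma sets_tilted_prob [measurable_cong]: "sets (tilted_prob F v) = sets (PiM {1..} (\<lambda>_. borel))"
  unfolding tilted_prob_def by (intro sets_PiM_cong) (simp_all add: sets_tilted)

lemma expectation_exp_Z1: "(LINT \<xi>|P. exp (w * Z 1 \<xi>)) = mgf"
proof -
  have "mgf = (LINT z|distr (PiM {1::nat..} (\<lambda>_. F)) F (\<lambda>\<omega>. \<omega> 1). exp (w * z))"
    by (subst P.PiM_component) (auto simp: mgf_def)
  also have "\<dots> = (LINT \<xi>|P. exp (w * Z 1 \<xi>))"
    unfolding P_eq Z_def by (intro integral_distr) auto
  finally show ?thesis ..
qed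

text \<open>The Radon-Nikodym derivative of \<open>Pw\<close> with respect to \<open>P\<close> on the first \<open>n\<close> coordinates.\<close>

definition likelihood :: "nat \<Rightarrow> (nat \<Rightarrow> real) \<Rightarrow> real" where
  "likelihood n \<omega> = exp (w * S n \<omega>) / mgf ^ n"

lemma likelihood_pos: "likelihood n \<omega> > 0"
  using mgf_pos by (simp add: likelihood_def)

lemma likelihood_prod: "likelihood n \<omega> = (\<Prod>i\<in>{1..n}. exp (w * \<omega> i) / mgf)"
  by (simp add: likelihood_def S_def Z_def sum_distrib_left exp_sum prod_dividef)

lemma borel_measurable_likelihood [measurable]: "likelihood n \<in> borel_measurable P"
  unfolding likelihood_def S_def Z_def by measurable

lemma sets_cylinders: "sigma_sets Omega (cylinders n) \<subseteq> sets (tilted_prob F v)"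
proof -
  have "cylinders n \<subseteq> sets (tilted_prob F v)"
  proof
    fix A assume "A \<in> cylinders n"
    then obtain X where A: "A = {\<omega>\<in>Omega. \<forall>i\<in>{1..n}. \<omega> i \<in> X i}"
      and [measurable]: "\<And>i. X i \<in> sets borel"
      unfolding cylinders_def by blast
    show "A \<in> sets (tilted_prob F v)"
      unfolding A space_tilted_prob[of F v, symmetric] by measurable
  qed
  then show ?thesis
    unfolding space_tilted_prob[of F v, symmetric] by (rule sets.sigma_sets_subset)
qed

text \<open>The indicator of a cylinder and the likelihood are both products over the coordinates
  \<open>1, \<dots>, n\<close>, so both sides reduce to the density of a single tilted coordinate.\<close>

lemma emeasure_Pw_cylinder:
  assumes "A \<in> cylinders n"
  shows "emeasure Pw A = emeasure (density P (\<lambda>\<omega>. ennreal (likelihood n \<omega>))) A"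
proof -
  from assms obtain X where A: "A = {\<omega>\<in>Omega. \<forall>i\<in>{1..n}. \<omega> i \<in> X i}"
    and X [measurable]: "\<And>i. X i \<in> sets borel"
    unfolding cylinders_def by blast
  have sets_A: "A \<in> sets (tilted_prob F v)" for v
    using sets_cylinders assms by blast
  have indicator_A: "indicator A \<omega> = (\<Prod>i\<in>{1..n}. indicator (X i) (\<omega> i) :: ennreal)"
    if "\<omega> \<in> Omega" for \<omega>
    using that by (auto simp: A indicator_def prod_zero_iff)
  have "emeasure Pw A = (\<integral>\<^sup>+\<omega>. (\<Prod>i\<in>{1..n}. indicator (X i) (\<omega> i)) \<partial>Pw)"
    by (subst nn_integral_indicator[OF sets_A, symmetric])
       (intro nn_integral_cong, simp add: space_tilted_prob indicator_A)
  also have "\<dots> = (\<Prod>i\<in>{1..n}. \<integral>\<^sup>+z. indicator (X i) z \<partial>tilted F w)"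
    unfolding Pw_eq
    by (intro Pw.nn_integral_PiM_prod borel_measurable_indicator) (auto simp: sets_tilted)
  also have "\<dots> = (\<Prod>i\<in>{1..n}. \<integral>\<^sup>+z. ennreal (exp (w * z) / mgf) * indicator (X i) z \<partial>F)"
    unfolding tilted_w by (intro prod.cong refl nn_integral_density) auto
  also have "\<dots> = (\<integral>\<^sup>+\<omega>. (\<Prod>i\<in>{1..n}. ennreal (exp (w * \<omega> i) / mgf) * indicator (X i) (\<omega> i)) \<partial>P)"
    unfolding P_eq by (intro P.nn_integral_PiM_prod[symmetric]) auto
  also have "\<dots> = (\<integral>\<^sup>+\<omega>. ennreal (likelihood n \<omega>) * indicator A \<omega> \<partial>P)"
    using mgf_pos
    by (intro nn_integral_cong)
       (simp add: space_tilted_prob indicator_A likelihood_prod prod.distrib prod_ennreal)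
  also have "\<dots> = emeasure (density P (\<lambda>\<omega>. ennreal (likelihood n \<omega>))) A"
    using sets_A by (intro emeasure_density[symmetric]) auto
  finally show ?thesis .
qed

text \<open>Measures that agree on an intersection-stable generator are equal. As \<open>Pw\<close> and the
  weighted \<open>P\<close> live on a larger \<open>\<sigma>\<close>-algebra, where they may differ, the uniqueness theorem is
  applied to their restrictions to the \<open>\<sigma>\<close>-algebra of the cylinders.\<close>

lemma emeasure_Pw_generated_sigma:
  assumes "A \<in> generated_sigma n"
  shows "emeasure Pw A = emeasure (density P (\<lambda>\<omega>. ennreal (likelihood n \<omega>))) A"
proof -
  let ?D = "density P (\<lambda>\<omega>. ennreal (likelihood n \<omega>))"
  let ?G = "sigma Omega (cylinders n)"
  have cyl_Pow: "cylinders n \<subseteq> Pow Omega"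
    by (auto simp: cylinders_def)
  have sub_Pw: "subalgebra Pw ?G" and sub_D: "subalgebra ?D ?G"
    using sets_cylinders cyl_Pow by (auto simp: subalgebra_def space_tilted_prob)
  have A: "A \<in> sets ?G"
    using assms generated_sigma_subset_cylinders cyl_Pow by auto
  have cyl_G: "X \<in> sets ?G" if "X \<in> cylinders n" for X
    using that cyl_Pow by auto
  have Omega_cyl: "Omega \<in> cylinders n"
    unfolding cylinders_def by (intro CollectI exI[of _ "\<lambda>_. UNIV"]) auto
  have "restr_to_subalg Pw ?G = restr_to_subalg ?D ?G"
  proof (rule measure_eqI_generator_eq[OF Int_stable_cylinders cyl_Pow, where A = "\<lambda>_. Omega"])
    fix X assume X: "X \<in> cylinders n"
    show "emeasure (restr_to_subalg Pw ?G) X = emeasure (restr_to_subalg ?D ?G) X"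
      using emeasure_Pw_cylinder[OF X]
      by (simp add: emeasure_restr_to_subalg[OF sub_Pw cyl_G[OF X]]
          emeasure_restr_to_subalg[OF sub_D cyl_G[OF X]])
  next
    show "sets (restr_to_subalg Pw ?G) = sigma_sets Omega (cylinders n)"
      using cyl_Pow by (simp add: sets_restr_to_subalg[OF sub_Pw])
    show "sets (restr_to_subalg ?D ?G) = sigma_sets Omega (cylinders n)"
      using cyl_Pow by (simp add: sets_restr_to_subalg[OF sub_D])
    show "emeasure (restr_to_subalg Pw ?G) Omega \<noteq> \<infinity>"
      using finite_measure.emeasure_finite[OF prob_space.finite_measure[OF prob_space_Pw], of Omega]
      unfolding emeasure_restr_to_subalg[OF sub_Pw cyl_G[OF Omega_cyl]] by simp
  qed (use Omega_cyl in auto)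
  then have "emeasure (restr_to_subalg Pw ?G) A = emeasure (restr_to_subalg ?D ?G) A"
    by simp
  then show ?thesis
    by (simp add: emeasure_restr_to_subalg[OF sub_Pw A] emeasure_restr_to_subalg[OF sub_D A])
qed

section \<open>Change of measure at a stopping time\<close>

lemma measurable_stopping_time_Z:
  assumes T: "stopping_time_Z T"
  shows "T \<in> measurable (tilted_prob F v) (count_space UNIV)"
proof -
  have fin: "{\<omega>\<in>Omega. T \<omega> = enat n} \<in> sets (tilted_prob F v)" for n
  proof (cases "n = 0")
    \<comment> \<open>\<open>stopping_time_Z\<close> controls \<open>T = n\<close> only for \<open>n \<ge> 1\<close>; the value \<open>0\<close> is excluded by \<open>T \<ge> 1\<close>.\<close>
    case True
    then have "{\<omega>\<in>Omega. T \<omega> = enat n} = {}"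
      using T by (auto simp: stopping_time_Z_def zero_enat_def[symmetric])
    then show ?thesis
      by (simp only: sets.empty_sets)
  next
    case False
    then have "{\<omega>\<in>Omega. T \<omega> = enat n} \<in> generated_sigma n"
      using T by (auto simp: stopping_time_Z_def)
    then show ?thesis
      using generated_sigma_subset_cylinders[of n] sets_cylinders[of n v] by blast
  qed
  have inf: "{\<omega>\<in>Omega. T \<omega> = \<infinity>} \<in> sets (tilted_prob F v)"
  proof -
    have "{\<omega>\<in>Omega. T \<omega> = \<infinity>} = space (tilted_prob F v) - (\<Union>n. {\<omega>\<in>Omega. T \<omega> = enat n})"
      by (auto simp: space_tilted_prob)
    also have "\<dots> \<in> sets (tilted_prob F v)"
      using fin by (intro sets.compl_sets sets.countable_UN) auto
    finally show ?thesis .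
  qed
  show ?thesis
  proof (subst measurable_count_space_eq_countable)
    have "T -` {k} \<inter> space (tilted_prob F v) \<in> sets (tilted_prob F v)" for k
    proof -
      have "T -` {k} \<inter> space (tilted_prob F v) = {\<omega>\<in>Omega. T \<omega> = k}"
        by (auto simp: space_tilted_prob)
      then show ?thesis
        using fin inf by (cases k) auto
    qed
    then show "T \<in> space (tilted_prob F v) \<rightarrow> UNIV \<and>
        (\<forall>k\<in>UNIV. T -` {k} \<inter> space (tilted_prob F v) \<in> sets (tilted_prob F v))"
      by simp
  qed simp
qed

lemma borel_measurable_at_time_likelihood:
  assumes T: "stopping_time_Z T"
  shows "at_time likelihood T \<in> borel_measurable P"
proof -
  have [measurable]: "T \<in> measurable P (count_space UNIV)"
    by (rule measurable_stopping_time_Z[OF T])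
  have "(\<lambda>\<omega>. (\<lambda>k \<omega>. case k of enat n \<Rightarrow> likelihood n \<omega> | \<infinity> \<Rightarrow> 0) (T \<omega>) \<omega>) \<in> borel_measurable P"
  proof (rule measurable_compose_countable)
    show "(\<lambda>\<omega>. case k of enat n \<Rightarrow> likelihood n \<omega> | \<infinity> \<Rightarrow> 0) \<in> borel_measurable P" for k
      by (cases k) auto
  qed measurable
  then show ?thesis
    by (simp add: at_time_def[abs_def])
qed

text \<open>A law on the countable set \<open>enat\<close> is determined by its point masses. At \<open>n\<close> these agree
  because \<open>T = n\<close> is an event of the first \<open>n\<close> coordinates. At \<open>\<infinity>\<close> both vanish: under \<open>Pw\<close> by
  assumption, and under the weighted \<open>P\<close> because \<open>at_time\<close> makes the density \<open>0\<close> there.\<close>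

lemma distr_stopping_time_Pw:
  assumes T: "stopping_time_Z T" and fin: "measure Pw {\<omega>\<in>Omega. T \<omega> < \<infinity>} = 1"
  shows "distr Pw (count_space UNIV) T =
    distr (density P (\<lambda>\<omega>. ennreal (at_time likelihood T \<omega>))) (count_space UNIV) T"
    (is "_ = distr ?D _ _")
proof (rule measure_eqI_countable[of _ UNIV])
  note [measurable] = measurable_stopping_time_Z[OF T]
  note [measurable] = borel_measurable_at_time_likelihood[OF T]
  have T_event: "{\<omega>\<in>Omega. T \<omega> = k} \<in> sets (tilted_prob F v)" for k v
    unfolding space_tilted_prob[of F v, symmetric] by measurable
  have T_fin_event: "{\<omega>\<in>Omega. T \<omega> < \<infinity>} \<in> sets (tilted_prob F v)" for v
    unfolding space_tilted_prob[of F v, symmetric] by measurable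
  fix k :: enat
  have "emeasure Pw {\<omega>\<in>Omega. T \<omega> = k} = emeasure ?D {\<omega>\<in>Omega. T \<omega> = k}"
  proof (cases k)
    case (enat n)
    have "emeasure Pw {\<omega>\<in>Omega. T \<omega> = k} =
        emeasure (density P (\<lambda>\<omega>. ennreal (likelihood n \<omega>))) {\<omega>\<in>Omega. T \<omega> = k}"
    proof (cases "n = 0")
      case True
      then have "{\<omega>\<in>Omega. T \<omega> = k} = {}"
        using T enat by (auto simp: stopping_time_Z_def zero_enat_def[symmetric])
      then show ?thesis
        by (simp only: emeasure_empty)
    next
      case False
      then show ?thesis
        using T enat by (intro emeasure_Pw_generated_sigma) (auto simp: stopping_time_Z_def)
    qed
    also have "\<dots> = emeasure ?D {\<omega>\<in>Omega. T \<omega> = k}"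
      using T_event[of k 0] enat
      by (auto simp: emeasure_density at_time_def indicator_def intro!: nn_integral_cong)
    finally show ?thesis .
  next
    case infinity
    have "{\<omega>\<in>Omega. T \<omega> = k} = space Pw - {\<omega>\<in>Omega. T \<omega> < \<infinity>}"
      using infinity by (auto simp: space_tilted_prob)
    then have "emeasure Pw {\<omega>\<in>Omega. T \<omega> = k} = 0"
      using prob_space.prob_compl[OF prob_space_Pw T_fin_event] fin
        finite_measure.emeasure_eq_measure[OF prob_space.finite_measure[OF prob_space_Pw]]
      by (simp only:) simp
    moreover have "emeasure ?D {\<omega>\<in>Omega. T \<omega> = k} = 0"
    proof -
      have "ennreal (at_time likelihood T \<omega>) * indicator {\<omega>\<in>Omega. T \<omega> = k} \<omega> = 0" for \<omega>
        using infinity by (cases "T \<omega>") (simp_all add: at_time_def indicator_def)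
      then show ?thesis
        using T_event[of k 0]
        by (subst emeasure_density) (auto simp del: mult_eq_0_iff)
    qed
    ultimately show ?thesis
      by simp
  qed
  moreover have "T -` {k} \<inter> space Pw = {\<omega>\<in>Omega. T \<omega> = k}" "T -` {k} \<inter> space ?D = {\<omega>\<in>Omega. T \<omega> = k}"
    by (auto simp: space_tilted_prob)
  ultimately show "emeasure (distr Pw (count_space UNIV) T) {k} =
      emeasure (distr ?D (count_space UNIV) T) {k}"
    by (simp add: emeasure_distr)
qed simp_all

text \<open>Transporting both sides to the law of \<open>T\<close> gives an equality of Bochner integrals outright:
  the two sides are integrable together, and otherwise both are \<open>0\<close> by convention.\<close>

theorem wald_likelihood_ratio_identity:
  fixes h :: "nat \<Rightarrow> real"
  assumes T: "stopping_time_Z T" and fin: "measure Pw {\<omega>\<in>Omega. T \<omega> < \<infinity>} = 1"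
  shows "(LINT \<omega>|Pw. at_time (\<lambda>n \<omega>. h n) T \<omega>) =
    (LINT \<omega>|P. at_time (\<lambda>n \<omega>. likelihood n \<omega> * h n) T \<omega>)"
proof -
  note [measurable] = measurable_stopping_time_Z[OF T]
  note [measurable] = borel_measurable_at_time_likelihood[OF T]
  define H where "H k = (case k of enat n \<Rightarrow> h n | \<infinity> \<Rightarrow> 0)" for k
  let ?D = "density P (\<lambda>\<omega>. ennreal (at_time likelihood T \<omega>))"
  have "(LINT \<omega>|Pw. at_time (\<lambda>n \<omega>. h n) T \<omega>) = (LINT k|distr Pw (count_space UNIV) T. H k)"
    by (subst integral_distr) (auto simp: H_def at_time_def[abs_def])
  also have "\<dots> = (LINT k|distr ?D (count_space UNIV) T. H k)"
    unfolding distr_stopping_time_Pw[OF T fin] ..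
  also have "\<dots> = (LINT \<omega>|?D. H (T \<omega>))"
    by (intro integral_distr) auto
  also have "\<dots> = (LINT \<omega>|P. at_time likelihood T \<omega> *\<^sub>R H (T \<omega>))"
    using likelihood_pos
    by (intro integral_density) (auto simp: at_time_def less_imp_le split: enat.split)
  also have "\<dots> = (LINT \<omega>|P. at_time (\<lambda>n \<omega>. likelihood n \<omega> * h n) T \<omega>)"
    by (intro Bochner_Integration.integral_cong) (auto simp: H_def at_time_def split: enat.split)
  finally show ?thesis .
qed

end

theorem corollary2:
  fixes F :: "real measure" and W :: "real set" and w :: real
    and T :: "(nat \<Rightarrow> real) \<Rightarrow> enat"
  defines "P \<equiv> tilted_prob F 0" and "Pw \<equiv> tilted_prob F w"
  assumes "real_distribution F"
    and "is_interval W" and "0 \<in> W"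
    and "\<And>v. v \<in> W \<Longrightarrow> integrable F (\<lambda>z. exp (v * z))"
    and "w \<in> W"
    and "stopping_time_Z T"
    and "measure P {\<omega>\<in>Omega. T \<omega> < \<infinity>} = 1"
    and "measure Pw {\<omega>\<in>Omega. T \<omega> < \<infinity>} = 1"
  shows "(\<forall>u::real.
            integrable P (at_time (\<lambda>n \<omega>. u ^ n * exp (w * S n \<omega>)) T) \<longrightarrow>
            integrable Pw (at_time (\<lambda>n \<omega>. (u * (LINT \<xi>|P. exp (w * Z 1 \<xi>))) ^ n) T) \<longrightarrow>
            (LINT \<omega>|P. at_time (\<lambda>n \<omega>. u ^ n * exp (w * S n \<omega>)) T \<omega>) =
            (LINT \<omega>|Pw. at_time (\<lambda>n \<omega>. (u * (LINT \<xi>|P. exp (w * Z 1 \<xi>))) ^ n) T \<omega>)) \<and>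
         (LINT \<omega>|P. at_time (\<lambda>n \<omega>. exp (w * S n \<omega>)) T \<omega>) =
         (LINT \<omega>|Pw. at_time (\<lambda>n \<omega>. (LINT \<xi>|P. exp (w * Z 1 \<xi>)) ^ n) T \<omega>)"
proof -
  interpret exponential_tilt F w
    using assms(3,6,7) by (intro exponential_tilt.intro exponential_tilt_axioms.intro)
  have cancel: "likelihood n \<omega> * (u * mgf) ^ n = u ^ n * exp (w * S n \<omega>)" for n u \<omega>
    using mgf_pos by (simp add: likelihood_def power_mult_distrib)
  have identity: "(LINT \<omega>|P. at_time (\<lambda>n \<omega>. u ^ n * exp (w * S n \<omega>)) T \<omega>) =
      (LINT \<omega>|Pw. at_time (\<lambda>n \<omega>. (u * (LINT \<xi>|P. exp (w * Z 1 \<xi>))) ^ n) T \<omega>)" for u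
    using wald_likelihood_ratio_identity[of T "\<lambda>n. (u * mgf) ^ n"] assms(8,10)
    unfolding P_def Pw_def expectation_exp_Z1 cancel by simp
  show ?thesis
    using identity identity[of 1] by simp
qed

end
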